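(* Let $C_L,S,N$ be positive integers with $C_L>S$ and $\gcd(C_L,1+S)=1$. In the collision model described in the context, the total expected worst transmission delay is $$E[W_{delay}^{total}]=\bigl(C_L(S+1)-S\bigr)\left(\frac{C_L-1}{C_L}\right)^{N-1}\sum_{t=0}^{\infty}(t+1)\left(1-\left(\frac{C_L-1}{C_L}\right)^{N-1}\right)^{t},$$ where $0^0=1$.
   Context: Time is divided into slots. A sensor with duty-cycle length $C_L$ first arriving at slot $n\in\{1,\dots,C_L\}$ transmits at slots $n+jC_L$, $j\in\mathbb{N}=\{0,1,2,\dots\}$. A gateway is awake exactly at slots $1+k(1+S)$, $k\in\mathbb{N}$ (one wakeup slot followed by $S$ sleeping slots, repeated). For each $n$ let $C_L^{\min}(n)$ be the least $j\in\mathbb{N}$ such that $n+jC_L=1+k(1+S)$ for some $k\in\mathbb{N}$ (it exists since $\gcd(C_L,1+S)=1$). The worst transmission delay caused by the wakeup-sleep operation is $W_{delay}=\max_{1\le n\le C_L}\bigl(n+C_L^{\min}(n)C_L\bigr)$, attained by the worst sensor $T^{\max}$. Collision model: there are $N$ sensors, including the worst sensor. Reception of the worst sensor is attempted in successive independent rounds. In each round, each of the other $N-1$ sensors independently and uniformly at random chooses one of the $C_L$ slots of a duty-cycle. The round is successful if none of them chooses the slot used by the worst sensor, and otherwise it is a collision. Let $Pr(s)$ and $Pr(c)=1-Pr(s)$ be the probabilities of success and of collision in one round. Rounds continue until the first success. Each round, whether it ends in a collision or is the final successful one, contributes a delay $W_{delay}$. So if there are exactly $t$ collisions before the first success, the total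 delay is $W_{delay}^t=(t+1)W_{delay}$, which happens with probability $Pr(c)^t\,Pr(s)$. $E[W_{delay}^{total}]$ is the expectation of this total delay. *)

theory Defs
  imports "HOL-Probability.Probability"
begin

definition awake_slots :: "nat \<Rightarrow> nat set" where
  "awake_slots S = {1 + k * (1 + S) | k. True}"

definition C_min :: "nat \<Rightarrow> nat \<Rightarrow> nat \<Rightarrow> nat" where
  "C_min C S n = (LEAST j. n + j * C \<in> awake_slots S)"

definition sensor_delay :: "nat \<Rightarrow> nat \<Rightarrow> nat \<Rightarrow> nat" where
  "sensor_delay C S n = n + C_min C S n * C"

definition W_delay :: "nat \<Rightarrow> nat \<Rightarrow> nat" where
  "W_delay C S = Max (sensor_delay C S ` {1..C})"

text \<open>The worst sensor transmits once per duty-cycle, always at the position where it first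
  arrived; this position is the slot of the duty-cycle it occupies in every round.\<close>

definition worst_slot :: "nat \<Rightarrow> nat \<Rightarrow> nat" where
  "worst_slot C S = (ARG_MAX (sensor_delay C S) n. n \<in> {1..C})"

text \<open>A sample point assigns to the pair \<open>(t, i)\<close> the slot chosen in round \<open>t\<close> (counted from 0)
  by sensor \<open>i\<close>, where \<open>{1..<N}\<close> indexes the \<open>N - 1\<close> sensors other than the worst one.
  The product measure makes all choices, within and across rounds, independent.\<close>

definition choice_space :: "nat \<Rightarrow> nat \<Rightarrow> (nat \<times> nat \<Rightarrow> nat) measure" where
  "choice_space C N = (\<Pi>\<^sub>M ti \<in> UNIV \<times> {1..<N}. measure_pmf (pmf_of_set {1..C}))"

definition round_success ::
    "nat \<Rightarrow> nat \<Rightarrow> nat \<Rightarrow> (nat \<times> nat \<Rightarrow> nat) \<Rightarrow> nat \<Rightarrow> bool" where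
  "round_success C S N \<omega> t \<longleftrightarrow> (\<forall>i\<in>{1..<N}. \<omega> (t, i) \<noteq> worst_slot C S)"

text \<open>The least successful round index is the number of collisions before the first success.
  If no round ever succeeds, the delay is infinite.\<close>

definition total_delay ::
    "nat \<Rightarrow> nat \<Rightarrow> nat \<Rightarrow> (nat \<times> nat \<Rightarrow> nat) \<Rightarrow> ennreal" where
  "total_delay C S N \<omega> =
     (if \<exists>t. round_success C S N \<omega> t
      then of_nat (((LEAST t. round_success C S N \<omega> t) + 1) * W_delay C S)
      else \<infinity>)"

text \<open>The delay takes values in \<open>[0, \<infinity>]\<close>, so its expectation is the nonnegative integral.\<close>

definition expected_total_delay :: "nat \<Rightarrow> nat \<Rightarrow> nat \<Rightarrow> ennreal" where
  "expected_total_delay C S N = (\<integral>\<^sup>+ \<omega>. total_delay C S N \<omega> \<partial>choice_space C N)"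

end

theory Submission
  imports Defs "HOL-Number_Theory.Cong"
begin

text \<open>The slots \<open>n + j C\<close> congruent to \<open>1\<close> modulo \<open>S + 1\<close> have their indices \<open>j\<close> in a single
  residue class, so the least index is the only one below \<open>S + 1\<close>. Hence every delay is an awake slot
  at most \<open>C (S + 1)\<close>, that is at most \<open>C (S + 1) - S\<close>, and this value is attained at the sensor with
  first slot congruent to it modulo \<open>C\<close>. The rounds are independent because they read disjoint blocks
  of coordinates of the product space, so the number of collisions is geometric with success
  probability \<open>((C - 1) / C) ^ (N - 1) > 0\<close>; in particular a success occurs almost surely.\<close>

section \<open>The worst delay\<close>

text \<open>Congruences can be multiplied and cancelled without naming \<open>k\<close>. The
  conjunct \<open>m \<ge> 1\<close> excludes \<open>0\<close>, which satisfies the congruence when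
  \<open>S = 0\<close>.\<close>

lemma awake_slots_iff: "m \<in> awake_slots S \<longleftrightarrow> m \<ge> 1 \<and> [m = 1] (mod (1 + S))"
proof
  have "[1 + k * (1 + S) = 1] (mod (1 + S))" for k
    unfolding cong_def by (rule mod_mult_self1)
  moreover assume "m \<in> awake_slots S"
  ultimately show "m \<ge> 1 \<and> [m = 1] (mod (1 + S))"
    unfolding awake_slots_def by fastforce
next
  assume m: "m \<ge> 1 \<and> [m = 1] (mod (1 + S))"
  then have "(1 + S) dvd (m - 1)"
    using cong_altdef_nat by blast
  then obtain k where "m - 1 = (1 + S) * k"
    by auto
  then have "m = 1 + k * (1 + S)"
    using m by (metis le_add_diff_inverse mult.commute)
  then show "m \<in> awake_slots S"
    unfolding awake_slots_def by blast
qed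

text \<open>Being coprime to the modulus, \<open>C\<close> can be cancelled from the difference of
  the two slots.\<close>

lemma awake_index_cong:
  assumes "coprime C (1 + S)" "n + i * C \<in> awake_slots S" "n + j * C \<in> awake_slots S"
  shows "[i = j] (mod (1 + S))"
proof -
  have "[n + i * C = n + j * C] (mod (1 + S))"
    using assms(2,3) unfolding awake_slots_iff by (metis cong_sym cong_trans)
  then have "[i * C = j * C] (mod (1 + S))"
    by (simp only: cong_add_lcancel_nat)
  then show ?thesis
    using assms(1) by (simp only: cong_mult_rcancel_nat)
qed

text \<open>An index below the modulus is the least element of its residue class, so exhibiting one
  such index evaluates the \<open>LEAST\<close>.\<close>

lemma C_min_eq:
  assumes "coprime C (1 + S)" "j < 1 + S" "n + j * C \<in> awake_slots S"
  shows "C_min C S n = j"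
  unfolding C_min_def
proof (rule Least_equality)
  fix i assume i: "n + i * C \<in> awake_slots S"
  show "j \<le> i"
    using awake_index_cong[OF assms(1) i assms(3)] assms(2)
    by (metis cong_def mod_less mod_less_eq_dividend)
qed fact

lemma ex_awake_index:
  assumes "coprime C (1 + S)" "n \<ge> 1"
  shows "\<exists>j<1 + S. n + j * C \<in> awake_slots S"
proof -
  obtain x where x: "[C * x = 1] (mod (1 + S))"
    using cong_solve_coprime_nat[OF assms(1)] by auto
  \<comment> \<open>The index must solve \<open>i * C = 1 - n\<close> modulo \<open>1 + S\<close>.
    Here \<open>x\<close> inverts \<open>C\<close>, and \<open>S\<close> stands for
    \<open>-1\<close>, which avoids subtraction on naturals.\<close>
  define i where "i = x * (1 + n * S)"
  have "i * C = C * x * (1 + n * S)"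
    by (simp only: i_def ac_simps)
  then have "[n + i * C = n + 1 * (1 + n * S)] (mod (1 + S))"
    using cong_add[OF cong_refl cong_mult[OF x cong_refl]] by metis
  also have "n + 1 * (1 + n * S) = 1 + n * (1 + S)"
    by (simp add: algebra_simps)
  also have "[1 + n * (1 + S) = 1] (mod (1 + S))"
    unfolding cong_def by (rule mod_mult_self1)
  finally have i: "[n + i * C = 1] (mod (1 + S))" .
  have "[n + (i mod (1 + S)) * C = n + i * C] (mod (1 + S))"
    by (intro cong_add cong_mult cong_refl) (simp add: cong_def)
  from cong_trans[OF this i] have "n + (i mod (1 + S)) * C \<in> awake_slots S"
    using assms(2) by (simp add: awake_slots_iff)
  then show ?thesis
    by (intro exI[of _ "i mod (1 + S)"]) simp
qed

lemma sensor_delay_le: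
  assumes "coprime C (1 + S)" "n \<in> {1..C}"
  shows "sensor_delay C S n \<le> C * (S + 1) - S"
proof -
  obtain j where j: "j < 1 + S" "n + j * C \<in> awake_slots S"
    using ex_awake_index[of C S n] assms by auto
  have delay: "sensor_delay C S n = n + j * C"
    using C_min_eq[OF assms(1) j] by (simp add: sensor_delay_def)
  have "n + j * C \<le> C + S * C"
    using assms(2) j(1) by (intro add_mono mult_right_mono) auto
  then have le: "n + j * C \<le> C * (1 + S)"
    by (simp add: algebra_simps)
  obtain k where k: "n + j * C = 1 + k * (1 + S)"
    using j(2) unfolding awake_slots_def by blast
  \<comment> \<open>The summand \<open>1\<close> of an awake slot makes the inequality strict, hence
    \<open>k \<le> C - 1\<close>; this is where the bound drops by \<open>S\<close>.\<close>
  with le have "k * (1 + S) < C * (1 + S)"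
    by linarith
  then have "k < C"
    unfolding mult_less_cancel2 by blast
  then have "(k + 1) * (1 + S) \<le> C * (1 + S)"
    by (intro mult_right_mono) auto
  with k show ?thesis
    unfolding delay by (simp add: algebra_simps)
qed

lemma sensor_delay_attained:
  assumes "coprime C (1 + S)" "C > 0"
  shows "\<exists>n\<in>{1..C}. sensor_delay C S n = C * (S + 1) - S"
proof -
  \<comment> \<open>\<open>1 + y\<close> is the last awake slot up to \<open>C * (1 + S)\<close>.
    Division of \<open>y\<close> by \<open>C\<close> yields the index as quotient and the first slot
    as remainder, shifted by one into \<open>{1..C}\<close>.\<close>
  define y where "y = (C - 1) * (1 + S)"
  define n where "n = y mod C + 1"
  have "y + S + 1 = C * (S + 1)"
    unfolding y_def using assms(2) by (cases C) (simp_all add: algebra_simps)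
  then have y: "C * (S + 1) - S = 1 + y" "y < (1 + S) * C"
    by (simp_all add: algebra_simps)
  have n: "n + (y div C) * C = 1 + y"
    by (simp add: n_def mult.commute)
  have "n + (y div C) * C \<in> awake_slots S"
    unfolding n unfolding y_def awake_slots_def by blast
  moreover have "y div C < 1 + S"
    using y(2) by (simp add: less_mult_imp_div_less)
  ultimately have "sensor_delay C S n = C * (S + 1) - S"
    using C_min_eq[OF assms(1)] n y(1) by (simp add: sensor_delay_def)
  moreover have "n \<in> {1..C}"
    using assms(2) by (simp add: n_def Suc_leI)
  ultimately show ?thesis
    by blast
qed

lemma W_delay_eq:
  assumes "coprime C (1 + S)" "C > 0"
  shows "W_delay C S = C * (S + 1) - S"
  unfolding W_delay_def
proof (rule Max_eqI)
  show "C * (S + 1) - S \<in> sensor_delay C S ` {1..C}"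
    using sensor_delay_attained[OF assms] by force
qed (use sensor_delay_le[OF assms(1)] in auto)

lemma worst_slot_in:
  assumes "C > 0"
  shows "worst_slot C S \<in> {1..C}"
proof -
  \<comment> \<open>The rule \<open>arg_max_natI\<close> asks for a strict upper bound, hence the
    successor of the maximum.\<close>
  have "\<forall>n. n \<in> {1..C} \<longrightarrow> sensor_delay C S n < Suc (W_delay C S)"
    by (auto simp: W_delay_def less_Suc_eq_le)
  moreover have "1 \<in> {1..C}"
    using assms by simp
  ultimately show ?thesis
    unfolding worst_slot_def by (intro arg_max_natI)
qed

section \<open>Independent trials\<close>

text \<open>Independence amounts to the joint distribution being the product of the marginals; for
  coordinates, both are the product measure itself.\<close>

lemma indep_vars_PiM_coordinates:
  assumes M: "\<And>i. i \<in> I \<Longrightarrow> prob_space (M i)"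
  shows "prob_space.indep_vars (PiM I M) M (\<lambda>i \<omega>. \<omega> i) I"
proof -
  interpret prob_space "PiM I M"
    by (rule prob_space_PiM) (rule M)
  show ?thesis
  proof (cases "I = {}")
    case True
    then show ?thesis
      unfolding indep_vars_def indep_sets_def by blast
  next
    case False
    \<comment> \<open>Points of the product space are extensional, so restricting them to
      \<open>I\<close> changes nothing.\<close>
    have "distr (PiM I M) (PiM I M) (\<lambda>x. restrict x I) = distr (PiM I M) (PiM I M) (\<lambda>x. x)"
      by (intro distr_cong) (auto simp: space_PiM PiE_restrict)
    also have "\<dots> = PiM I M"
      by simp
    also have "\<dots> = PiM I (\<lambda>i. distr (PiM I M) (M i) (\<lambda>\<omega>. \<omega> i))"
      using M by (intro PiM_cong refl) (simp add: distr_PiM_component)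
    finally show ?thesis
      using False by (subst indep_vars_iff_distr_eq_PiM') auto
  qed
qed

lemma (in prob_space) prob_first_success:
  fixes X :: "nat \<Rightarrow> 'a \<Rightarrow> bool"
  assumes indep: "indep_vars (\<lambda>_. count_space UNIV) X UNIV"
    and prob: "\<And>t. prob {\<omega> \<in> space M. X t \<omega>} = p"
  shows "prob {\<omega> \<in> space M. X t \<omega> \<and> (\<forall>j<t. \<not> X j \<omega>)} = (1 - p) ^ t * p"
proof -
  have [measurable]: "X t \<in> measurable M (count_space UNIV)" for t
    using indep by (auto simp: indep_vars_def)
  \<comment> \<open>Writing the required outcome of each trial as a set turns the event into an
    intersection of preimages, whose probability factors.\<close>
  define A where "A j = (if j = t then {True} else {False})" for j
  have "prob {\<omega> \<in> space M. X t \<omega> \<and> (\<forall>j<t. \<not> X j \<omega>)} =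
      prob (\<Inter>j\<in>{..t}. X j -` A j \<inter> space M)"
  proof (rule arg_cong[where f = prob])
    show "{\<omega> \<in> space M. X t \<omega> \<and> (\<forall>j<t. \<not> X j \<omega>)} = (\<Inter>j\<in>{..t}. X j -` A j \<inter> space M)"
      by (auto simp: A_def le_less split: if_splits)
  qed
  also have "\<dots> = (\<Prod>j\<in>{..t}. prob (X j -` A j \<inter> space M))"
    by (intro indep_varsD[OF indep]) auto
  also have "\<dots> = (\<Prod>j\<in>{..t}. if j = t then p else 1 - p)"
  proof (intro prod.cong refl)
    fix j
    have *: "X i -` {True} \<inter> space M = {\<omega> \<in> space M. X i \<omega>}"
      "X i -` {False} \<inter> space M = space M - {\<omega> \<in> space M. X i \<omega>}" for i
      by auto
    show "prob (X j -` A j \<inter> space M) = (if j = t then p else 1 - p)"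
      unfolding A_def by (simp add: * prob prob_compl)
  qed
  also have "\<dots> = (1 - p) ^ t * p"
    by (simp add: atMost_Suc lessThan_Suc_atMost [symmetric])
  finally show ?thesis .
qed

text \<open>The events \<open>F t\<close> of a first success at \<open>t\<close> are disjoint, and
  their geometric probabilities sum to \<open>1\<close> because \<open>p > 0\<close>. They therefore
  cover almost every point, the integrand is \<open>f t\<close> on \<open>F t\<close>, and the value
  \<open>c\<close> is taken only on a null set.\<close>

lemma (in prob_space) nn_integral_first_success:
  fixes X :: "nat \<Rightarrow> 'a \<Rightarrow> bool" and f :: "nat \<Rightarrow> ennreal"
  assumes indep: "indep_vars (\<lambda>_. count_space UNIV) X UNIV"
    and prob: "\<And>t. prob {\<omega> \<in> space M. X t \<omega>} = p" and "p > 0"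
  shows "(\<integral>\<^sup>+\<omega>. (if \<exists>t. X t \<omega> then f (LEAST t. X t \<omega>) else c) \<partial>M) =
    (\<Sum>t. f t * ennreal ((1 - p) ^ t * p))"
proof -
  have [measurable]: "X t \<in> measurable M (count_space UNIV)" for t
    using indep by (auto simp: indep_vars_def)
  define F where "F t = {\<omega> \<in> space M. X t \<omega> \<and> (\<forall>j<t. \<not> X j \<omega>)}" for t
  have F [measurable]: "F t \<in> events" for t
    unfolding F_def by measurable
  have prob_F: "prob (F t) = (1 - p) ^ t * p" for t
    unfolding F_def by (rule prob_first_success[OF indep prob])
  have first: "\<omega> \<in> F t \<Longrightarrow> (LEAST t. X t \<omega>) = t" for \<omega> t
    unfolding F_def by (rule Least_equality) (auto simp: not_less [symmetric])
  have disj: "disjoint_family F"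
    unfolding disjoint_family_on_def using first by blast
  have "p \<le> 1"
    using prob[of 0] prob_le_1 by metis
  then have "(\<lambda>t. (1 - p) ^ t * p) sums (1 / (1 - (1 - p)) * p)"
    using \<open>p > 0\<close> by (intro sums_mult2 geometric_sums) simp
  then have "(\<lambda>t. prob (F t)) sums 1"
    using \<open>p > 0\<close> by (simp add: prob_F)
  moreover have "(\<lambda>t. prob (F t)) sums prob (\<Union>t. F t)"
    using disj by (intro finite_measure_UNION) auto
  ultimately have "prob (\<Union>t. F t) = 1"
    by (rule sums_unique2[symmetric])
  then have "AE \<omega> in M. \<omega> \<in> (\<Union>t. F t)"
    by (rule AE_prob_1)
  then have "AE \<omega> in M. (if \<exists>t. X t \<omega> then f (LEAST t. X t \<omega>) else c) =
      (\<Sum>t. f t * indicator (F t) \<omega>)"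
  proof eventually_elim
    case (elim \<omega>)
    then obtain s where s: "\<omega> \<in> F s"
      by blast
    \<comment> \<open>By disjointness only the term of the actual first success \<open>s\<close>
      survives.\<close>
    have "(\<Sum>t. f t * indicator (F t) \<omega>) = (\<Sum>t\<in>{s}. f t * indicator (F t) \<omega>)"
      using s first by (intro suminf_finite) (auto simp: indicator_def)
    moreover have "X s \<omega>"
      using s by (simp add: F_def)
    ultimately show ?case
      using s first[OF s] by auto
  qed
  then have "(\<integral>\<^sup>+\<omega>. (if \<exists>t. X t \<omega> then f (LEAST t. X t \<omega>) else c) \<partial>M) =
      (\<integral>\<^sup>+\<omega>. (\<Sum>t. f t * indicator (F t) \<omega>) \<partial>M)"
    by (rule nn_integral_cong_AE)
  also have "\<dots> = (\<Sum>t. \<integral>\<^sup>+\<omega>. f t * indicator (F t) \<omega> \<partial>M)"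
    by (rule nn_integral_suminf) measurable
  also have "\<dots> = (\<Sum>t. f t * ennreal ((1 - p) ^ t * p))"
    by (simp add: nn_integral_cmult_indicator emeasure_eq_measure prob_F)
  finally show ?thesis .
qed

section \<open>The collision model\<close>

lemma prob_space_choice_space: "prob_space (choice_space C N)"
  unfolding choice_space_def by (intro prob_space_PiM prob_space_measure_pmf)

text \<open>Grouping independent coordinates into the disjoint blocks \<open>?K t\<close> keeps them
  independent, and so does applying the measurable predicate \<open>?Y t\<close> to each
  block.\<close>

lemma indep_vars_round_success:
  "prob_space.indep_vars (choice_space C N) (\<lambda>_. count_space UNIV)
    (\<lambda>t \<omega>. round_success C S N \<omega> t) UNIV"
proof -
  interpret prob_space "choice_space C N"
    by (rule prob_space_choice_space)
  let ?M = "\<lambda>_ :: nat \<times> nat. measure_pmf (pmf_of_set {1..C})"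
  let ?K = "\<lambda>t :: nat. {t} \<times> {1..<N}"
  let ?Y = "\<lambda>t x. \<forall>i\<in>{1..<N}. x (t, i) \<noteq> worst_slot C S"
  have "indep_vars ?M (\<lambda>i \<omega>. \<omega> i) (UNIV \<times> {1..<N})"
    unfolding choice_space_def
    by (intro indep_vars_PiM_coordinates prob_space_measure_pmf)
  then have "indep_vars (\<lambda>t. PiM (?K t) ?M) (\<lambda>t \<omega>. restrict (\<lambda>i. \<omega> i) (?K t)) UNIV"
    by (rule indep_vars_restrict) (auto simp: disjoint_family_on_def)
  moreover have "?Y t \<in> measurable (PiM (?K t) ?M) (count_space UNIV)" for t
  proof -
    have "(\<lambda>x. x (t, i)) \<in> measurable (PiM (?K t) ?M) (count_space UNIV)" if "i \<in> {1..<N}" for i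
      using measurable_component_singleton[of "(t, i)" "?K t" ?M] that
      by (simp cong: measurable_cong_sets)
    then show ?thesis
      by measurable
  qed
  ultimately have "indep_vars (\<lambda>_. count_space UNIV)
      (\<lambda>t \<omega>. ?Y t (restrict (\<lambda>i. \<omega> i) (?K t))) UNIV"
    by (rule indep_vars_compose2)
  moreover have "?Y t (restrict (\<lambda>i. \<omega> i) (?K t)) = round_success C S N \<omega> t" for t \<omega>
    unfolding round_success_def by (intro ball_cong) auto
  ultimately show ?thesis
    by simp
qed

text \<open>Success is a cylinder event: each of the \<open>N - 1\<close> coordinates of the round
  must avoid one slot, so its measure is a finite product.\<close>

lemma prob_round_success:
  assumes "C > 0"
  shows "measure (choice_space C N) {\<omega> \<in> space (choice_space C N). round_success C S N \<omega> t} =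
    ((real C - 1) / real C) ^ (N - 1)"
proof -
  let ?P = "measure_pmf (pmf_of_set {1..C})"
  interpret product_prob_space "\<lambda>_. ?P" "UNIV \<times> {1..<N}"
    by (intro product_prob_spaceI prob_space_measure_pmf)
  have choice: "measure ?P (- {worst_slot C S}) = (real C - 1) / real C"
  proof -
    have "{1..C} \<inter> - {worst_slot C S} = {1..C} - {worst_slot C S}"
      by auto
    then show ?thesis
      \<comment> \<open>That the worst slot lies in \<open>{1..C}\<close> ensures that exactly
        \<open>C - 1\<close> choices remain.\<close>
      using assms worst_slot_in[OF assms, of S]
      by (simp add: measure_pmf_of_set of_nat_diff)
  qed
  have "emeasure (choice_space C N) {\<omega> \<in> space (choice_space C N). round_success C S N \<omega> t} =
      (\<Prod>ti\<in>{t} \<times> {1..<N}. emeasure ?P (- {worst_slot C S}))"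
    using emeasure_PiM_Collect[of "{t} \<times> {1..<N}" "\<lambda>_. - {worst_slot C S}"]
    by (simp add: choice_space_def round_success_def Sigma_mono)
  also have "\<dots> = ennreal (((real C - 1) / real C) ^ (N - 1))"
    unfolding measure_pmf.emeasure_eq_measure choice using assms by (simp add: ennreal_power)
  finally show ?thesis
    using assms by (simp add: measure_def)
qed

theorem theorem2:
  fixes C S N :: nat
  assumes "C > 0" and "S > 0" and "N > 0"
    and "C > S"
    and "gcd C (1 + S) = 1"
  shows "summable (\<lambda>t. (real t + 1) * (1 - ((real C - 1) / real C) ^ (N - 1)) ^ t) \<and>
    expected_total_delay C S N =
      ennreal ((real C * (real S + 1) - real S) * ((real C - 1) / real C) ^ (N - 1) *
        (\<Sum>t. (real t + 1) * (1 - ((real C - 1) / real C) ^ (N - 1)) ^ t))"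
proof -
  define p where "p = ((real C - 1) / real C) ^ (N - 1)"
  define w where "w = real C * (real S + 1) - real S"
  \<comment> \<open>This follows from \<open>C > S > 0\<close> and gives \<open>p > 0\<close>; for
    \<open>C = 1\<close> any further sensor would always collide.\<close>
  have "C \<ge> 2"
    using assms by linarith
  then have p: "0 < p" "p \<le> 1"
    unfolding p_def by (auto intro!: power_le_one zero_less_power)
  \<comment> \<open>This is the termwise derivative of the geometric series at \<open>1 - p\<close>,
    which lies in \<open>[0, 1)\<close>.\<close>
  have summ: "summable (\<lambda>t. (real t + 1) * (1 - p) ^ t)"
    using geometric_deriv_sums[of "1 - p"] p by (auto simp: sums_iff add.commute)
  \<comment> \<open>Without truncation, the natural subtraction in \<open>W_delay_eq\<close> agrees
    with the real one in \<open>w\<close>.\<close>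
  have "S \<le> C * (S + 1)"
    using assms(1) by (cases C) auto
  then have w: "real (W_delay C S) = w"
    using W_delay_eq[of C S] assms
    by (simp add: w_def coprime_iff_gcd_eq_1 of_nat_diff algebra_simps)
  then have "w \<ge> 0"
    using of_nat_0_le_iff by metis
  interpret prob_space "choice_space C N"
    by (rule prob_space_choice_space)
  have "expected_total_delay C S N =
      (\<Sum>t. of_nat ((t + 1) * W_delay C S) * ennreal ((1 - p) ^ t * p))"
    unfolding expected_total_delay_def total_delay_def
    using prob_round_success[OF assms(1)] p(1)
    by (intro nn_integral_first_success indep_vars_round_success) (auto simp: p_def)
  also have "\<dots> = (\<Sum>t. ennreal (w * p * ((real t + 1) * (1 - p) ^ t)))"
  proof (rule suminf_cong)
    fix t
    have "of_nat ((t + 1) * W_delay C S) = ennreal ((real t + 1) * w)"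
      by (simp add: ennreal_of_nat_eq_real_of_nat w algebra_simps)
    moreover have "0 \<le> (1 - p) ^ t * p"
      using p by simp
    ultimately show "of_nat ((t + 1) * W_delay C S) * ennreal ((1 - p) ^ t * p) =
        ennreal (w * p * ((real t + 1) * (1 - p) ^ t))"
      by (simp only: ennreal_mult'' [symmetric] ac_simps)
  qed
  \<comment> \<open>Nonnegative terms and summability let the extended sum be taken over the
    reals.\<close>
  also have "\<dots> = ennreal (\<Sum>t. w * p * ((real t + 1) * (1 - p) ^ t))"
    using p \<open>w \<ge> 0\<close> summ by (intro suminf_ennreal2 summable_mult) auto
  also have "\<dots> = ennreal (w * p * (\<Sum>t. (real t + 1) * (1 - p) ^ t))"
    using summ by (simp add: suminf_mult)
  finally show ?thesis
    using summ unfolding p_def w_def by blast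
qed

end
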